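(* If the sequence $(a_n)_{n \ge 1}$ of non-negative real numbers is bounded, then the associated Rademacher random walk is weakly recurrent.
   Context: Let $\epsilon_1, \epsilon_2, \dots$ be independent Rademacher random variables, taking values $\pm 1$ each with probability $1/2$. The Rademacher random walk associated with a deterministic sequence $(a_n)_{n\ge1}$ of non-negative reals is $(X_n)_{n\ge 0}$, $X_n = \sum_{k=1}^n \epsilon_k a_k$. The walk is weakly recurrent if $\mathbb{P}(\exists C<\infty : |X_n| \le C \text{ for infinitely many } n) = 1$. *)

theory Defs
  imports "HOL-Probability.Probability"
begin

text \<open>The two probabilities add up to 1, so a Rademacher variable is \<open>\<plusminus>1\<close> almost surely.\<close>

definition (in prob_space) rademacher :: "('a \<Rightarrow> real) \<Rightarrow> bool" where
  "rademacher X \<longleftrightarrow> random_variable borel X \<and>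
     prob {\<omega> \<in> space M. X \<omega> = 1} = 1 / 2 \<and> prob {\<omega> \<in> space M. X \<omega> = -1} = 1 / 2"

text \<open>Sequences are indexed from 1; the value at index 0 is never used.\<close>

definition (in prob_space) iid_rademacher :: "(nat \<Rightarrow> 'a \<Rightarrow> real) \<Rightarrow> bool" where
  "iid_rademacher \<epsilon> \<longleftrightarrow>
     indep_vars (\<lambda>_. borel) \<epsilon> {1..} \<and> (\<forall>n\<ge>1. rademacher (\<epsilon> n))"

definition rademacher_walk :: "(nat \<Rightarrow> 'a \<Rightarrow> real) \<Rightarrow> (nat \<Rightarrow> real) \<Rightarrow> nat \<Rightarrow> 'a \<Rightarrow> real" where
  "rademacher_walk \<epsilon> a n \<omega> = (\<Sum>k=1..n. \<epsilon> k \<omega> * a k)"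

definition (in prob_space) weakly_recurrent :: "(nat \<Rightarrow> 'a \<Rightarrow> real) \<Rightarrow> bool" where
  "weakly_recurrent X \<longleftrightarrow>
     prob {\<omega> \<in> space M. \<exists>C::real. infinite {n. \<bar>X n \<omega>\<bar> \<le> C}} = 1"

end

theory Submission
  imports Defs
begin

text \<open>
  Suppose that the steps are bounded and that \<open>\<bar>X\<^sub>n\<bar>\<close> tends to infinity. Eventually \<open>X\<^sub>n\<close> is
  farther from the origin than any step is long, so it can no longer change its sign, and \<open>X\<^sub>n\<close> tends
  to \<open>\<infinity>\<close> or to \<open>-\<infinity>\<close> (\<open>diverges_if_abs_large_and_steps_bounded\<close>). It remains to see
  that neither happens with positive probability.

  Finitely many steps do not influence whether \<open>X\<^sub>n\<close> tends to \<open>\<infinity>\<close>, so Kolmogorov's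
  zero-one law gives this event probability 0 or 1
  (\<open>prob_partial_sums_at_top_0_1\<close>). As the independent steps are symmetric, \<open>-X\<close> has the same law
  as \<open>X\<close>, and the event of divergence to \<open>-\<infinity>\<close> has the same probability
  (\<open>prob_partial_sums_at_top_uminus\<close>). The two events are disjoint, so they cannot both have
  probability 1, and both are null.
\<close>

section \<open>Divergence of real sequences\<close>

lemma filterlim_at_top_sequentially_nat_iff:
  fixes f :: "nat \<Rightarrow> real"
  shows "filterlim f at_top sequentially \<longleftrightarrow> (\<forall>Z::nat. \<exists>N. \<forall>n\<ge>N. real Z \<le> f n)"
proof
  assume "\<forall>Z::nat. \<exists>N. \<forall>n\<ge>N. real Z \<le> f n"
  then have "eventually (\<lambda>n. Z \<le> f n) sequentially" for Z
    unfolding eventually_sequentially by (meson order_trans real_arch_simple)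
  then show "filterlim f at_top sequentially"
    by (simp add: filterlim_at_top)
qed (auto simp: filterlim_at_top eventually_sequentially)

lemma measurable_filterlim_at_top_sequentially:
  fixes f :: "nat \<Rightarrow> 'a \<Rightarrow> real"
  assumes [measurable]: "\<And>n. f n \<in> borel_measurable N"
  shows "{\<omega> \<in> space N. filterlim (\<lambda>n. f n \<omega>) at_top sequentially} \<in> sets N"
  unfolding filterlim_at_top_sequentially_nat_iff by measurable

lemma filterlim_at_top_sum_tail_iff:
  fixes y :: "nat \<Rightarrow> real"
  shows "filterlim (\<lambda>n. \<Sum>k<n. y k) at_top sequentially \<longleftrightarrow>
    filterlim (\<lambda>n. \<Sum>k\<in>{m..<n}. y k) at_top sequentially"
proof -
  have tail: "eventually (\<lambda>n. (\<Sum>k<n. y k) = (\<Sum>k<m. y k) + (\<Sum>k\<in>{m..<n}. y k)) sequentially"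
    using eventually_ge_at_top[of m]
    by eventually_elim
      (metis atLeast0LessThan sum.atLeastLessThan_concat zero_le)
  have "filterlim (\<lambda>n. \<Sum>k<n. y k) at_top sequentially \<longleftrightarrow>
      filterlim (\<lambda>n. (\<Sum>k<m. y k) + (\<Sum>k\<in>{m..<n}. y k)) at_top sequentially"
    by (rule filterlim_cong[OF refl refl tail])
  also have "\<dots> \<longleftrightarrow> filterlim (\<lambda>n. \<Sum>k\<in>{m..<n}. y k) at_top sequentially"
  proof
    assume "filterlim (\<lambda>n. (\<Sum>k<m. y k) + (\<Sum>k\<in>{m..<n}. y k)) at_top sequentially"
    from filterlim_tendsto_add_at_top[OF tendsto_const this, of "- (\<Sum>k<m. y k)"]
    show "filterlim (\<lambda>n. \<Sum>k\<in>{m..<n}. y k) at_top sequentially"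
      by simp
  qed (rule filterlim_tendsto_add_at_top[OF tendsto_const])
  finally show ?thesis .
qed

text \<open>Outside \<open>[-K, K]\<close>, a step of length at most \<open>K\<close> cannot cross the origin.\<close>

lemma diverges_if_abs_large_and_steps_bounded:
  fixes x :: "nat \<Rightarrow> real"
  assumes large: "\<And>C. finite {n. \<bar>x n\<bar> \<le> C}"
    and step: "\<And>n. \<bar>x (Suc n) - x n\<bar> \<le> K"
  shows "filterlim x at_top sequentially \<or> filterlim (\<lambda>n. - x n) at_top sequentially"
proof -
  have ev: "eventually (\<lambda>n. C < \<bar>x n\<bar>) sequentially" for C
    using large[of C] by (simp add: cofinite_eq_sequentially[symmetric] eventually_cofinite not_less)
  then obtain N where N: "\<And>n. n \<ge> N \<Longrightarrow> K < \<bar>x n\<bar>"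
    unfolding eventually_sequentially by blast
  have K: "0 \<le> K"
    using step[of 0] by linarith
  have keep_sign: "0 < s * x n" if "0 < s * x N" "\<bar>s\<bar> = 1" "n \<ge> N" for n s
    using that(3)
  proof (induction n rule: dec_induct)
    case (step n)
    have "s = 1 \<or> s = -1"
      using that(2) by linarith
    then show ?case
      using step.IH N[OF step.hyps(1)] assms(2)[of n] K by (auto simp: abs_if split: if_splits)
  qed (rule that(1))
  have diverges: "filterlim (\<lambda>n. s * x n) at_top sequentially" if "0 < s * x N" "\<bar>s\<bar> = 1" for s
    unfolding filterlim_at_top
  proof
    fix Z
    show "eventually (\<lambda>n. Z \<le> s * x n) sequentially"
      using ev[of Z] eventually_ge_at_top[of N]
    proof eventually_elim
      case (elim n)
      have "\<bar>x n\<bar> = \<bar>s * x n\<bar>"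
        using that(2) by (simp add: abs_mult)
      then show ?case
        using elim keep_sign[OF that, of n] by linarith
    qed
  qed
  have "x N > 0 \<or> x N < 0"
    using N[of N] K by auto
  then show ?thesis
    using diverges[of 1] diverges[of "-1"] by auto
qed

section \<open>Partial sums of independent variables\<close>

context prob_space
begin

lemma prob_partial_sums_at_top_0_1:
  fixes Y :: "nat \<Rightarrow> 'a \<Rightarrow> real"
  assumes indep: "indep_vars (\<lambda>_. borel) Y UNIV"
  shows "prob {\<omega> \<in> space M. filterlim (\<lambda>n. \<Sum>k<n. Y k \<omega>) at_top sequentially} \<in> {0, 1}"
    (is "prob ?E \<in> _")
proof -
  define F where "F i = sigma_sets (space M) {Y i -` A \<inter> space M |A. A \<in> sets borel}" for i
  have F_Pow: "F i \<subseteq> Pow (space M)" for i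
  proof
    fix B
    assume "B \<in> F i"
    moreover have "{Y i -` A \<inter> space M |A. A \<in> sets borel} \<subseteq> Pow (space M)"
      by blast
    ultimately show "B \<in> Pow (space M)"
      unfolding F_def by (auto dest: sigma_sets_into_sp)
  qed
  have "?E \<in> tail_events F"
    unfolding tail_events_def
  proof (rule INT_I)
    fix m
    \<comment> \<open>The sum from \<open>m\<close> on diverges as the whole sum does, and involves only the variables from \<open>m\<close> on.\<close>
    define N where "N = sigma (space M) (\<Union> (F ` {m..}))"
    have space_N: "space N = space M"
      by (simp add: N_def space_measure_of_conv)
    have sets_N: "sets N = sigma_sets (space M) (\<Union> (F ` {m..}))"
      unfolding N_def using F_Pow by (intro sets_measure_of) blast
    have "Y i \<in> borel_measurable N" if "i \<ge> m" for i
    proof (rule measurableI)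
      fix A :: "real set"
      assume "A \<in> sets borel"
      then have "Y i -` A \<inter> space M \<in> F i"
        unfolding F_def by blast
      then show "Y i -` A \<inter> space N \<in> sets N"
        using that unfolding space_N sets_N by blast
    qed simp
    then have "(\<lambda>\<omega>. \<Sum>k\<in>{m..<n}. Y k \<omega>) \<in> borel_measurable N" for n
      by (intro borel_measurable_sum) simp
    from measurable_filterlim_at_top_sequentially[where f="\<lambda>n \<omega>. \<Sum>k\<in>{m..<n}. Y k \<omega>", OF this]
    show "?E \<in> sigma_sets (space M) (\<Union> (F ` {m..}))"
      unfolding space_N sets_N filterlim_at_top_sum_tail_iff[of _ m, symmetric] .
  qed
  moreover have "sigma_algebra (space M) (F i)" for i
    unfolding F_def by (intro sigma_algebra_sigma_sets) blast
  moreover have "indep_sets F UNIV"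
    using indep unfolding indep_vars_def F_def by simp
  ultimately show ?thesis
    using kolmogorov_0_1_law[of F ?E] by simp
qed

text \<open>The joint law of independent variables is the product of their laws, so that changing the
  signs of symmetric variables preserves it.\<close>

lemma prob_partial_sums_at_top_uminus:
  fixes Y :: "nat \<Rightarrow> 'a \<Rightarrow> real"
  assumes indep: "indep_vars (\<lambda>_. borel) Y UNIV"
    and symmetric: "\<And>k. distr M borel (\<lambda>\<omega>. - Y k \<omega>) = distr M borel (Y k)"
  shows "prob {\<omega> \<in> space M. filterlim (\<lambda>n. - (\<Sum>k<n. Y k \<omega>)) at_top sequentially} =
    prob {\<omega> \<in> space M. filterlim (\<lambda>n. \<Sum>k<n. Y k \<omega>) at_top sequentially}"
proof -
  let ?P = "Pi\<^sub>M UNIV (\<lambda>_::nat. borel :: real measure)"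
  define S where "S = {y \<in> space ?P. filterlim (\<lambda>n. \<Sum>k<n. y k :: real) at_top sequentially}"
  have S: "S \<in> sets ?P"
    unfolding S_def by (intro measurable_filterlim_at_top_sequentially) measurable
  have law: "distr M ?P (\<lambda>\<omega> k. Z k \<omega>) = Pi\<^sub>M UNIV (\<lambda>k. distr M borel (Z k))"
    and Z_meas: "(\<lambda>\<omega> k. Z k \<omega>) \<in> measurable M ?P"
    if "indep_vars (\<lambda>_. borel) Z UNIV" for Z :: "nat \<Rightarrow> 'a \<Rightarrow> real"
  proof -
    have rv: "\<And>k. random_variable borel (Z k)"
      using that unfolding indep_vars_def by simp
    then show "distr M ?P (\<lambda>\<omega> k. Z k \<omega>) = Pi\<^sub>M UNIV (\<lambda>k. distr M borel (Z k))"
      using that indep_vars_iff_distr_eq_PiM[where I=UNIV and X=Z and M'="\<lambda>_. borel"]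
      by (simp add: restrict_def)
    show "(\<lambda>\<omega> k. Z k \<omega>) \<in> measurable M ?P"
      using rv by (intro measurable_PiM_single') (auto simp: space_PiM)
  qed
  have prob_S: "prob {\<omega> \<in> space M. filterlim (\<lambda>n. \<Sum>k<n. Z k \<omega>) at_top sequentially} =
      measure (Pi\<^sub>M UNIV (\<lambda>k. distr M borel (Z k))) S"
    if "indep_vars (\<lambda>_. borel) Z UNIV" for Z :: "nat \<Rightarrow> 'a \<Rightarrow> real"
    unfolding law[OF that, symmetric] measure_distr[OF Z_meas[OF that] S]
    by (rule arg_cong[where f=prob]) (auto simp: S_def space_PiM)
  have indep_uminus: "indep_vars (\<lambda>_. borel) (\<lambda>k \<omega>. - Y k \<omega>) UNIV"
    by (rule indep_vars_compose2[OF indep, where Y="\<lambda>_. uminus"]) simp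
  show ?thesis
    using prob_S[OF indep] prob_S[OF indep_uminus] symmetric by (simp add: sum_negf)
qed

text \<open>Divergence to \<open>\<infinity>\<close> and to \<open>-\<infinity>\<close> are disjoint and equally likely, so each has probability at
  most 1/2; the zero-one law leaves only 0.\<close>

lemma prob_symmetric_partial_sums_at_top_eq_0:
  fixes Y :: "nat \<Rightarrow> 'a \<Rightarrow> real"
  assumes indep: "indep_vars (\<lambda>_. borel) Y UNIV"
    and symmetric: "\<And>k. distr M borel (\<lambda>\<omega>. - Y k \<omega>) = distr M borel (Y k)"
  shows "prob {\<omega> \<in> space M. filterlim (\<lambda>n. \<Sum>k<n. Y k \<omega>) at_top sequentially} = 0"
    (is "prob ?U = 0")
proof -
  let ?D = "{\<omega> \<in> space M. filterlim (\<lambda>n. - (\<Sum>k<n. Y k \<omega>)) at_top sequentially}"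
  have [measurable]: "\<And>k. random_variable borel (Y k)"
    using indep unfolding indep_vars_def by simp
  have events: "?U \<in> events" "?D \<in> events"
    by (intro measurable_filterlim_at_top_sequentially; measurable)+
  have "?U \<inter> ?D = {}"
  proof (rule ccontr)
    assume "?U \<inter> ?D \<noteq> {}"
    then obtain \<omega> where
      "filterlim (\<lambda>n. \<Sum>k<n. Y k \<omega>) at_top sequentially"
      "filterlim (\<lambda>n. - (\<Sum>k<n. Y k \<omega>)) at_top sequentially"
      by blast
    from filterlim_at_top_add_at_top[OF this]
    have "filterlim (\<lambda>n. 0::real) at_top sequentially"
      by simp
    then show False
      by (auto simp: filterlim_at_top eventually_sequentially dest: spec[of _ 1])
  qed
  then have "prob ?U + prob ?D = prob (?U \<union> ?D)"
    using events by (simp add: finite_measure_Union)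
  also have "\<dots> \<le> 1"
    by (rule prob_le_1)
  finally have "2 * prob ?U \<le> 1"
    by (simp add: prob_partial_sums_at_top_uminus[OF assms])
  then show ?thesis
    using prob_partial_sums_at_top_0_1[OF indep] by auto
qed

text \<open>Almost surely the partial sums diverge neither to \<open>\<infinity>\<close> nor to \<open>-\<infinity>\<close>, so some bounded region
  is visited infinitely often. The steps are bounded only almost everywhere because a Rademacher
  variable may take any value on a null set.\<close>

lemma weakly_recurrent_symmetric_bounded_partial_sums:
  fixes Y :: "nat \<Rightarrow> 'a \<Rightarrow> real"
  assumes indep: "indep_vars (\<lambda>_. borel) Y UNIV"
    and symmetric: "\<And>k. distr M borel (\<lambda>\<omega>. - Y k \<omega>) = distr M borel (Y k)"
    and bounded: "\<And>k. AE \<omega> in M. \<bar>Y k \<omega>\<bar> \<le> K"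
  shows "weakly_recurrent (\<lambda>n \<omega>. \<Sum>k<n. Y k \<omega>)"
proof -
  define X where "X n \<omega> = (\<Sum>k<n. Y k \<omega>)" for n \<omega>
  have Y [measurable]: "\<And>k. random_variable borel (Y k)"
    using indep unfolding indep_vars_def by simp
  have X [measurable]: "\<And>n. random_variable borel (X n)"
    unfolding X_def by measurable
  have AE_not: "AE \<omega> in M. \<not> filterlim (\<lambda>n. Z n \<omega>) at_top sequentially"
    if "\<And>n. random_variable borel (Z n)"
      "prob {\<omega> \<in> space M. filterlim (\<lambda>n. Z n \<omega>) at_top sequentially} = 0"
    for Z :: "nat \<Rightarrow> 'a \<Rightarrow> real"
    using that(2) measurable_filterlim_at_top_sequentially[OF that(1)]
    by (simp add: prob_Collect_eq_0)
  have null: "AE \<omega> in M. \<not> filterlim (\<lambda>n. X n \<omega>) at_top sequentially"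
    by (rule AE_not[OF X])
      (simp add: X_def prob_symmetric_partial_sums_at_top_eq_0[OF indep symmetric])
  have null': "AE \<omega> in M. \<not> filterlim (\<lambda>n. - X n \<omega>) at_top sequentially"
    by (rule AE_not, measurable)
      (simp add: X_def prob_partial_sums_at_top_uminus[OF indep symmetric]
        prob_symmetric_partial_sums_at_top_eq_0[OF indep symmetric])
  have "AE \<omega> in M. \<forall>k. \<bar>Y k \<omega>\<bar> \<le> K"
    using bounded by (simp add: AE_all_countable)
  with null null' have recurrent: "AE \<omega> in M. \<exists>C. infinite {n. \<bar>X n \<omega>\<bar> \<le> C}"
  proof eventually_elim
    case (elim \<omega>)
    show ?case
      using elim diverges_if_abs_large_and_steps_bounded[of "\<lambda>n. X n \<omega>" K] by (auto simp: X_def)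
  qed
  \<comment> \<open>Integer bounds suffice, which makes the event of weak recurrence a countable combination of events.\<close>
  have "(\<exists>C. infinite {n. \<bar>X n \<omega>\<bar> \<le> C}) \<longleftrightarrow> (\<exists>C::nat. \<forall>m. \<exists>n\<ge>m. \<bar>X n \<omega>\<bar> \<le> real C)" for \<omega>
  proof
    assume "\<exists>C. infinite {n. \<bar>X n \<omega>\<bar> \<le> C}"
    then obtain C where C: "infinite {n. \<bar>X n \<omega>\<bar> \<le> C}" ..
    obtain C' :: nat where "C \<le> real C'"
      using real_arch_simple by blast
    then have "infinite {n. \<bar>X n \<omega>\<bar> \<le> real C'}"
      using C by (auto elim!: contrapos_nn finite_subset[rotated])
    then show "\<exists>C::nat. \<forall>m. \<exists>n\<ge>m. \<bar>X n \<omega>\<bar> \<le> real C"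
      by (auto simp: infinite_nat_iff_unbounded_le)
  qed (auto simp: infinite_nat_iff_unbounded_le)
  then have "{\<omega> \<in> space M. \<exists>C. infinite {n. \<bar>X n \<omega>\<bar> \<le> C}} \<in> events"
    by simp
  then have "prob {\<omega> \<in> space M. \<exists>C. infinite {n. \<bar>X n \<omega>\<bar> \<le> C}} = 1"
    using recurrent by (subst prob_Collect_eq_1)
  then show ?thesis
    unfolding weakly_recurrent_def X_def .
qed

section \<open>Rademacher variables\<close>

lemma rademacher_AE:
  assumes "rademacher X"
  shows "AE \<omega> in M. X \<omega> = 1 \<or> X \<omega> = -1"
proof -
  have [measurable]: "random_variable borel X"
    using assms by (simp add: rademacher_def)
  have "prob {\<omega> \<in> space M. X \<omega> = 1 \<or> X \<omega> = -1} =
      prob ({\<omega> \<in> space M. X \<omega> = 1} \<union> {\<omega> \<in> space M. X \<omega> = -1})"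
    by (rule arg_cong[where f=prob]) blast
  also have "\<dots> = prob {\<omega> \<in> space M. X \<omega> = 1} + prob {\<omega> \<in> space M. X \<omega> = -1}"
    by (rule finite_measure_Union) (measurable, auto)
  also have "\<dots> = 1"
    using assms by (simp add: rademacher_def)
  finally show ?thesis
    by (rule prob_Collect_eq_1[THEN iffD1, rotated]) measurable
qed

lemma prob_rademacher:
  assumes X: "rademacher X" and [measurable]: "A \<in> sets borel"
  shows "prob (X -` A \<inter> space M) = (indicator A 1 + indicator A (-1)) / 2"
proof -
  have [measurable]: "random_variable borel X"
    using X by (simp add: rademacher_def)
  let ?V = "\<lambda>c. {\<omega> \<in> space M. X \<omega> = c \<and> c \<in> A}"
  have "prob (X -` A \<inter> space M) = prob (?V 1 \<union> ?V (-1))"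
    by (rule measure_eq_AE) (use rademacher_AE[OF X] in \<open>auto elim!: eventually_mono\<close>)
  also have "\<dots> = prob (?V 1) + prob (?V (-1))"
    by (rule finite_measure_Union) (measurable, auto)
  finally show ?thesis
    using X by (auto simp: rademacher_def indicator_def)
qed

lemma rademacher_uminus:
  assumes "rademacher X"
  shows "rademacher (\<lambda>\<omega>. - X \<omega>)"
proof -
  have "- X \<omega> = 1 \<longleftrightarrow> X \<omega> = -1" for \<omega>
    by linarith
  then show ?thesis
    using assms by (simp add: rademacher_def)
qed

lemma rademacher_distr_unique:
  assumes X: "rademacher X" and Y: "rademacher Y"
  shows "distr M borel X = distr M borel Y"
proof (rule measure_eqI)
  have [measurable]: "random_variable borel X" "random_variable borel Y"
    using X Y by (simp_all add: rademacher_def)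
  fix A
  assume "A \<in> sets (distr M borel X)"
  then show "emeasure (distr M borel X) A = emeasure (distr M borel Y) A"
    by (simp add: emeasure_distr emeasure_eq_measure prob_rademacher[OF X] prob_rademacher[OF Y])
qed simp

lemma rademacher_scaled_symmetric:
  assumes X: "rademacher X"
  shows "distr M borel (\<lambda>\<omega>. - (X \<omega> * c)) = distr M borel (\<lambda>\<omega>. X \<omega> * c)"
proof -
  have [measurable]: "random_variable borel X"
    using X by (simp add: rademacher_def)
  have "distr M borel (\<lambda>\<omega>. - (X \<omega> * c)) = distr (distr M borel (\<lambda>\<omega>. - X \<omega>)) borel (\<lambda>x. x * c)"
    by (subst distr_distr) (auto simp: comp_def)
  also have "\<dots> = distr (distr M borel X) borel (\<lambda>x. x * c)"
    by (simp add: rademacher_distr_unique[OF rademacher_uminus[OF X] X])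
  also have "\<dots> = distr M borel (\<lambda>\<omega>. X \<omega> * c)"
    by (subst distr_distr) (auto simp: comp_def)
  finally show ?thesis .
qed

lemma indep_vars_shift_scale:
  fixes \<epsilon> :: "nat \<Rightarrow> 'a \<Rightarrow> real"
  assumes "indep_vars (\<lambda>_. borel) \<epsilon> {1..}"
  shows "indep_vars (\<lambda>_. borel) (\<lambda>k \<omega>. \<epsilon> (Suc k) \<omega> * c (Suc k)) UNIV"
proof -
  \<comment> \<open>Shifting the index amounts to grouping the variables into the blocks \<open>{Suc k}\<close>.\<close>
  have "indep_vars (\<lambda>k. Pi\<^sub>M {Suc k} (\<lambda>_. borel))
      (\<lambda>k \<omega>. restrict (\<lambda>i. \<epsilon> i \<omega>) {Suc k}) UNIV"
    by (rule indep_vars_restrict[OF assms]) (auto simp: disjoint_family_on_def)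
  from indep_vars_compose2[OF this, where N="\<lambda>_. borel" and Y="\<lambda>k y. y (Suc k) * c (Suc k)"]
  show ?thesis
    by simp
qed

end

section \<open>Recurrence of the Rademacher walk\<close>

theorem corollary11:
  fixes M :: "'a measure" and \<epsilon> :: "nat \<Rightarrow> 'a \<Rightarrow> real" and a :: "nat \<Rightarrow> real"
  assumes "prob_space M"
    and "prob_space.iid_rademacher M \<epsilon>"
    and "\<And>n. n \<ge> 1 \<Longrightarrow> a n \<ge> 0"
    and "bounded (a ` {1..})"
  shows "prob_space.weakly_recurrent M (rademacher_walk \<epsilon> a)"
proof -
  interpret prob_space M by fact
  have indep: "indep_vars (\<lambda>_. borel) \<epsilon> {1..}" and rad: "rademacher (\<epsilon> (Suc k))" for k
    using assms(2) by (auto simp: iid_rademacher_def)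
  obtain K where K: "\<And>k. \<bar>a (Suc k)\<bar> \<le> K"
    using assms(4) unfolding bounded_iff by auto
  have "weakly_recurrent (\<lambda>n \<omega>. \<Sum>k<n. \<epsilon> (Suc k) \<omega> * a (Suc k))"
  proof (rule weakly_recurrent_symmetric_bounded_partial_sums)
    show "indep_vars (\<lambda>_. borel) (\<lambda>k \<omega>. \<epsilon> (Suc k) \<omega> * a (Suc k)) UNIV"
      by (rule indep_vars_shift_scale[OF indep])
    show "distr M borel (\<lambda>\<omega>. - (\<epsilon> (Suc k) \<omega> * a (Suc k))) =
        distr M borel (\<lambda>\<omega>. \<epsilon> (Suc k) \<omega> * a (Suc k))" for k
      by (rule rademacher_scaled_symmetric[OF rad])
    show "AE \<omega> in M. \<bar>\<epsilon> (Suc k) \<omega> * a (Suc k)\<bar> \<le> K" for k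
      using rademacher_AE[OF rad[of k]] K[of k] by (auto elim!: eventually_mono)
  qed
  then show ?thesis
    by (simp add: rademacher_walk_def[abs_def] sum.atLeast1_atMost_eq)
qed

end
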